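(* Let $r\ge 0$, $\rho\ge 0$, and let $E,K$ be nonnegative measurable functions on $(\mathbb{R}^+)^2$. Suppose that $$\lim_{t\to\infty}E(t+s,s)=0\quad\text{uniformly with respect to } s\in\mathbb{R}^+,$$ and that $\vartheta,\kappa$ are positive constants with $$\sup_{t\ge s\ge 0}E(t,s)\le\vartheta<\infty,\qquad \sup_{t\ge 0}\int_0^tK(t,s)\,ds\le\kappa<\infty .$$ Let $\mathscr{L}_r(E;K,0;\rho)$ be the set of nonnegative functions $y\in C([-r,\infty))$ satisfying $$y(t)\le E(t,\tau)\|y_\tau\|+\int_\tau^tK(t,s)\|y_s\|\,ds+\rho,\qquad \forall\, t\ge\tau\ge 0.$$ Set $\mu=1/(1-\kappa)$, $c=\max\big(\vartheta/(1-\kappa),1\big)$ and $\gamma=(\mu+1)/(1-\kappa c)$. (1) If $\kappa<1$, then for any $R,\varepsilon>0$ there exists $T>0$ such that $$\|y_t\|<\mu\rho+\varepsilon,\qquad t>T,$$ for all $y\in\mathscr{L}_r(E;K,0;\rho)$ with $\|y_0\|\le R$. (2) If $\kappa<1/(1+\vartheta)$, then there exist $M,\lambda>0$ such that for all $y\in\mathscr{L}_r(E;K,0;\rho)$, $$\|y_t\|\le M\|y_0\|e^{-\lambda t}+\gamma\rho,\qquad t\ge 0.$$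
   Context: $\mathbb{R}^+=[0,\infty)$. $\|\cdot\|$ is the sup-norm on $C([-r,0])$. For a continuous function $y$ on $[-r,\infty)$ and $t\ge 0$, the lift $y_t\in C([-r,0])$ is defined by $y_t(s)=y(t+s)$, $s\in[-r,0]$. The constant $\gamma$ is used only in part (2), where $\kappa c<1$. *)

theory Defs
  imports "HOL-Analysis.Analysis"
begin

text \<open>Functions on \<open>[-r, \<infinity>)\<close> and on \<open>[-r, 0]\<close> are total functions on the reals; values outside
  the intended domain are never used.\<close>

definition lift :: "(real \<Rightarrow> real) \<Rightarrow> real \<Rightarrow> real \<Rightarrow> real" where
  "lift y t = (\<lambda>s. y (t + s))"

text \<open>The supremum is taken in the conditionally complete lattice of the reals, so it is the
  intended one only for \<open>r \<ge> 0\<close> and \<open>\<phi>\<close> bounded on \<open>[-r, 0]\<close>, in particular for \<open>\<phi>\<close>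
  continuous there.\<close>

definition supnorm :: "real \<Rightarrow> (real \<Rightarrow> real) \<Rightarrow> real" where
  "supnorm r \<phi> = (SUP s\<in>{-r..0}. \<bar>\<phi> s\<bar>)"

text \<open>The solution class \<open>L\<^sub>r(E; K, 0; \<rho>)\<close>. The Bochner integral below has the default value 0 if its
  integrand is not integrable. This does not happen when \<open>K(t, \<cdot>)\<close> is integrable on \<open>[0, t]\<close>,
  since \<open>s \<mapsto> \<parallel>y\<^sub>s\<parallel>\<close> is continuous.\<close>

definition solution_class ::
  "real \<Rightarrow> (real \<Rightarrow> real \<Rightarrow> real) \<Rightarrow> (real \<Rightarrow> real \<Rightarrow> real) \<Rightarrow> real \<Rightarrow> (real \<Rightarrow> real) set" where
  "solution_class r E K \<rho> =
     {y. continuous_on {-r..} y \<and> (\<forall>t\<ge>-r. 0 \<le> y t) \<and>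
         (\<forall>\<tau> t. 0 \<le> \<tau> \<and> \<tau> \<le> t \<longrightarrow>
            y t \<le> E t \<tau> * supnorm r (lift y \<tau>)
                   + (LINT s:{\<tau>..t}|lebesgue. K t s * supnorm r (lift y s)) + \<rho>)}"

end

theory Submission imports Defs begin

text \<open>Write \<open>Y t = \<parallel>y\<^sub>t\<parallel>\<close>. Evaluating the inequality where \<open>y\<close> attains its maximum on
  \<open>[\<tau>, t]\<close> gives the a priori bound \<open>Y t \<le> c Y \<tau> + \<mu> \<rho>\<close> for \<open>t \<ge> \<tau>\<close>. The decay of \<open>E\<close> then yields,
  for every \<open>\<delta> > 0\<close>, a delay \<open>H\<close> such that \<open>Y t \<le> \<delta> Y \<tau> + \<kappa> b + \<rho>\<close> for \<open>t \<ge> \<tau> + H\<close> whenever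
  \<open>Y \<le> b\<close> on \<open>[\<tau>, \<infinity>)\<close>. In part (1) this is iterated with a bound \<open>b\<close> that improves
  geometrically with ratio \<open>\<kappa>\<close>. In part (2), \<open>b = c Y \<tau> + \<mu> \<rho>\<close> gives
  \<open>Y t \<le> q Y (t - H) + \<mu> \<rho>\<close> with \<open>q = \<kappa> c + \<delta>\<close>; for \<open>\<delta> = (1 - \<kappa> c) / (\<mu> + 1)\<close> the fixed point of
  this recursion is exactly \<open>\<gamma> \<rho>\<close>.\<close>

section \<open>Sup-norms of lifts\<close>

lemma supnorm_lift_le:
  assumes "r \<ge> 0" and "\<And>s. t - r \<le> s \<Longrightarrow> s \<le> t \<Longrightarrow> \<bar>y s\<bar> \<le> b"
  shows "supnorm r (lift y t) \<le> b"
  unfolding supnorm_def lift_def using assms by (intro cSUP_least) auto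

lemma abs_le_supnorm_lift:
  assumes "continuous_on {-r..} y" "t \<ge> 0" "t - r \<le> s" "s \<le> t"
  shows "\<bar>y s\<bar> \<le> supnorm r (lift y t)"
proof -
  have "continuous_on {-r..0} (\<lambda>s. \<bar>y (t + s)\<bar>)"
    by (intro continuous_intros continuous_on_compose2[OF assms(1)]) (use assms(2) in auto)
  then have "bdd_above ((\<lambda>s. \<bar>y (t + s)\<bar>) ` {-r..0})"
    by (intro bounded_imp_bdd_above compact_imp_bounded compact_continuous_image) auto
  from cSUP_upper[OF _ this, of "s - t"] show ?thesis
    using assms by (simp add: supnorm_def lift_def)
qed

lemma supnorm_lift_nonneg:
  assumes "continuous_on {-r..} y" "r \<ge> 0" "t \<ge> 0"
  shows "0 \<le> supnorm r (lift y t)"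
  using abs_le_supnorm_lift[OF assms(1,3), of t] assms(2) by linarith

text \<open>Iterating \<open>step\<close> from \<open>t\<close> backwards about \<open>t / H\<close>
  times gives \<open>B * q ^ n\<close> with \<open>n = \<lfloor>t / H\<rfloor>\<close>; passing from
  \<open>q ^ n\<close> to the exponential \<open>q\<close> to the power \<open>t / H\<close> costs
  the factor \<open>1 / q\<close>. Negative values of \<open>f\<close> are allowed, since the lemma
  is applied to \<open>\<parallel>y_t\<parallel> - \<gamma> * \<rho>\<close>.\<close>

lemma delayed_contraction_decay:
  fixes f :: "real \<Rightarrow> real"
  assumes "H > 0" "0 < q" "q < 1" and bound: "\<And>t. t \<ge> 0 \<Longrightarrow> f t \<le> B" and "B \<ge> 0"
    and step: "\<And>t. t \<ge> H \<Longrightarrow> f t \<le> q * f (t - H)" and "t \<ge> 0"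
  shows "f t \<le> B / q * exp (- (- ln q / H) * t)"
proof -
  have iter: "f t \<le> B * q ^ n" if "t \<ge> real n * H" for n t
    using that
  proof (induction n arbitrary: t)
    case 0
    then show ?case using bound by simp
  next
    case (Suc n)
    have "H \<le> t"
      using Suc.prems \<open>H > 0\<close> mult_nonneg_nonneg[of "real n" H]
      by (simp add: distrib_right del: mult_nonneg_nonneg)
    then have "f t \<le> q * f (t - H)" by (rule step)
    also have "\<dots> \<le> q * (B * q ^ n)"
      using Suc.prems \<open>q > 0\<close> by (intro mult_left_mono Suc.IH) (auto simp: algebra_simps)
    finally show ?case by (simp add: mult_ac)
  qed
  define n where "n = nat \<lfloor>t / H\<rfloor>"
  have th: "t / H \<ge> 0" using assms by simp
  have n: "real n \<le> t / H" "t / H \<le> real n + 1"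
    using th by (simp_all add: n_def)
  have "f t \<le> B * q ^ n" using n(1) \<open>H > 0\<close> by (intro iter) (simp add: field_simps)
  also have "q ^ n = exp (ln q * (real n + 1)) / q"
    using \<open>q > 0\<close> by (simp add: distrib_left exp_add mult.commute exp_of_nat_mult)
  \<comment> \<open>Since \<open>ln q < 0\<close>, the bound \<open>t / H \<le> n + 1\<close> is
    reversed in the exponent.\<close>
  also have "B * (exp (ln q * (real n + 1)) / q) \<le> B * (exp (ln q * (t / H)) / q)"
    using mult_left_mono_neg[OF n(2), of "ln q"] \<open>B \<ge> 0\<close> \<open>0 < q\<close> \<open>q < 1\<close>
    by (intro mult_left_mono divide_right_mono) auto
  finally show ?thesis by (simp add: mult_ac)
qed

section \<open>Estimates for a single solution when \<open>\<kappa> < 1\<close>\<close>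

locale delay_inequality =
  fixes r \<rho> \<theta> \<kappa> :: real and E K :: "real \<Rightarrow> real \<Rightarrow> real"
  assumes r: "r \<ge> 0" and \<rho>: "\<rho> \<ge> 0" and \<theta>: "\<theta> > 0" and \<kappa>: "\<kappa> > 0" "\<kappa> < 1"
    and K_nonneg: "\<And>t s. t \<ge> 0 \<Longrightarrow> s \<ge> 0 \<Longrightarrow> 0 \<le> K t s"
    and E_lim: "uniform_limit {0..} (\<lambda>t s. E (t + s) s) (\<lambda>s. 0) at_top"
    and E_bound: "\<And>t s. 0 \<le> s \<Longrightarrow> s \<le> t \<Longrightarrow> E t s \<le> \<theta>"
    and K_integrable: "\<And>t. t \<ge> 0 \<Longrightarrow> set_integrable lebesgue {0..t} (K t)"
    and K_bound: "\<And>t. t \<ge> 0 \<Longrightarrow> (LINT s:{0..t}|lebesgue. K t s) \<le> \<kappa>"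
begin

text \<open>The case split avoids proving that the product is integrable: if it is not, its integral
  has the default value 0, which is at most \<open>\<kappa> * b\<close> because \<open>b\<close> is
  nonnegative.\<close>

lemma integral_K_mult_le:
  assumes "0 \<le> \<tau>" "\<tau> \<le> t" "0 \<le> b" and Y: "\<And>s. \<tau> \<le> s \<Longrightarrow> s \<le> t \<Longrightarrow> Y s \<le> b"
  shows "(LINT s:{\<tau>..t}|lebesgue. K t s * Y s) \<le> \<kappa> * b"
proof (cases "set_integrable lebesgue {\<tau>..t} (\<lambda>s. K t s * Y s)")
  case True
  have int: "set_integrable lebesgue {\<tau>..t} (K t)"
    using K_integrable[of t] by (rule set_integrable_subset) (use assms in auto)
  have "(LINT s:{\<tau>..t}|lebesgue. K t s * Y s) \<le> (LINT s:{\<tau>..t}|lebesgue. K t s * b)"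
    using assms int by (intro set_integral_mono True mult_left_mono Y K_nonneg) auto
  also have "\<dots> = (LINT s:{\<tau>..t}|lebesgue. K t s) * b" by simp
  \<comment> \<open>Enlarging the domain to \<open>{0..t}\<close> can only increase the integral, as
    \<open>K\<close> is nonnegative.\<close>
  also have "(LINT s:{\<tau>..t}|lebesgue. K t s) \<le> (LINT s:{0..t}|lebesgue. K t s)"
    unfolding set_lebesgue_integral_def
    using assms int K_integrable[of t] K_nonneg[of t]
    by (intro integral_mono) (auto simp: set_integrable_def indicator_def)
  also have "\<dots> \<le> \<kappa>" using assms by (intro K_bound) simp
  finally show ?thesis using \<open>0 \<le> b\<close> by (simp add: mult_right_mono)
next
  case False
  then have "(LINT s:{\<tau>..t}|lebesgue. K t s * Y s) = 0"
    unfolding set_integrable_def set_lebesgue_integral_def by (rule not_integrable_integral_eq)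
  then show ?thesis using \<kappa> \<open>0 \<le> b\<close> by simp
qed

context
  fixes y assumes y: "y \<in> solution_class r E K \<rho>"
begin

lemma y_cont: "continuous_on {-r..} y"
  and y_nonneg: "t \<ge> -r \<Longrightarrow> 0 \<le> y t"
  using y by (auto simp: solution_class_def)

abbreviation "Y t \<equiv> supnorm r (lift y t)"

lemma Y_nonneg: "t \<ge> 0 \<Longrightarrow> 0 \<le> Y t"
  using supnorm_lift_nonneg[OF y_cont r] .

lemma y_le_Y: "t \<ge> 0 \<Longrightarrow> t - r \<le> s \<Longrightarrow> s \<le> t \<Longrightarrow> y s \<le> Y t"
  using abs_le_supnorm_lift[OF y_cont, of t s] by linarith

lemma Y_le:
  assumes "t \<ge> 0" "\<And>s. t - r \<le> s \<Longrightarrow> s \<le> t \<Longrightarrow> y s \<le> b"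
  shows "Y t \<le> b"
  using assms y_nonneg by (intro supnorm_lift_le r) auto

lemma y_le:
  assumes "0 \<le> \<tau>" "\<tau> \<le> t" "0 \<le> b" "\<And>s. \<tau> \<le> s \<Longrightarrow> s \<le> t \<Longrightarrow> Y s \<le> b"
  shows "y t \<le> E t \<tau> * Y \<tau> + \<kappa> * b + \<rho>"
proof -
  have "y t \<le> E t \<tau> * Y \<tau> + (LINT s:{\<tau>..t}|lebesgue. K t s * Y s) + \<rho>"
    using y assms by (simp add: solution_class_def)
  then show ?thesis using integral_K_mult_le[where Y = Y, OF assms] by linarith
qed

text \<open>If the maximum \<open>y x\<close> of \<open>y\<close> on \<open>{\<tau>..t}\<close>
  exceeds \<open>Y \<tau>\<close>, it bounds \<open>Y\<close> on \<open>{\<tau>..x}\<close>, so the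
  memory term at time \<open>x\<close> is at most \<open>\<kappa> * y x\<close> and is absorbed on
  the left. Otherwise \<open>Y t \<le> Y \<tau>\<close>, and the factor 1 inside the maximum
  suffices.\<close>

lemma a_priori_bound:
  assumes "0 \<le> \<tau>" "\<tau> \<le> t"
  shows "Y t \<le> max (\<theta> / (1 - \<kappa>)) 1 * Y \<tau> + 1 / (1 - \<kappa>) * \<rho>" (is "_ \<le> ?c * _ + ?\<mu> * _")
proof -
  have "\<exists>x\<in>{\<tau>..t}. \<forall>s\<in>{\<tau>..t}. y s \<le> y x"
    using assms r by (intro continuous_attains_sup continuous_on_subset[OF y_cont]) auto
  then obtain x where x: "\<tau> \<le> x" "x \<le> t" and max: "\<And>s. \<tau> \<le> s \<Longrightarrow> s \<le> t \<Longrightarrow> y s \<le> y x"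
    by auto
  \<comment> \<open>The window of length \<open>r\<close> ending at \<open>s\<close> splits at
    \<open>\<tau>\<close>: the earlier piece lies in the window of \<open>Y \<tau>\<close>, the
    later one in \<open>{\<tau>..t}\<close>.\<close>
  have Y_le_max: "Y s \<le> max (Y \<tau>) (y x)" if "\<tau> \<le> s" "s \<le> t" for s
  proof (rule Y_le)
    fix u assume "s - r \<le> u" "u \<le> s"
    then show "y u \<le> max (Y \<tau>) (y x)"
      using that assms max[of u] y_le_Y[of \<tau> u] by (cases "u \<le> \<tau>") (auto simp: le_max_iff_disj)
  qed (use that assms in auto)
  have "Y \<tau> \<le> ?c * Y \<tau>"
    using mult_right_mono[of 1 ?c "Y \<tau>"] Y_nonneg[of \<tau>] assms by simp
  moreover have "0 \<le> ?\<mu> * \<rho>" using \<kappa> \<rho> by simp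
  moreover have "y x \<le> ?c * Y \<tau> + ?\<mu> * \<rho>" if "Y \<tau> < y x"
  proof -
    have "y x \<le> E x \<tau> * Y \<tau> + \<kappa> * y x + \<rho>"
    proof (rule y_le)
      show "Y s \<le> y x" if "\<tau> \<le> s" "s \<le> x" for s
        using Y_le_max[of s] that \<open>Y \<tau> < y x\<close> x by simp
      show "0 \<le> y x" using x assms r by (intro y_nonneg) simp
    qed (use x assms in auto)
    moreover have "E x \<tau> * Y \<tau> \<le> \<theta> * Y \<tau>"
      using x assms by (intro mult_right_mono E_bound Y_nonneg) auto
    ultimately have "y x * (1 - \<kappa>) \<le> \<theta> * Y \<tau> + \<rho>" by (simp add: algebra_simps)
    then have "y x \<le> (\<theta> * Y \<tau> + \<rho>) / (1 - \<kappa>)" using \<kappa> by (simp add: pos_le_divide_eq)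
    also have "\<dots> = \<theta> / (1 - \<kappa>) * Y \<tau> + ?\<mu> * \<rho>" by (simp add: add_divide_distrib)
    also have "\<dots> \<le> ?c * Y \<tau> + ?\<mu> * \<rho>"
      using assms by (intro add_right_mono mult_right_mono Y_nonneg) auto
    finally show ?thesis .
  qed
  ultimately show ?thesis using Y_le_max[of t] assms by linarith
qed

end

text \<open>After a time \<open>L\<close> the factor \<open>E\<close> is below
  \<open>\<delta>\<close>; waiting \<open>r\<close> longer brings the whole window ending at
  \<open>t\<close> into that range. Uniformity of the limit makes \<open>H\<close> depend on
  \<open>\<delta>\<close> alone and not on \<open>y\<close>, \<open>\<tau>\<close> or
  \<open>b\<close>, so the estimate can be iterated.\<close>

lemma delay_estimate:
  assumes "\<delta> > 0"
  obtains H where "H > 0" and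
    "\<And>y \<tau> t b. \<lbrakk>y \<in> solution_class r E K \<rho>; 0 \<le> \<tau>; \<tau> + H \<le> t; 0 \<le> b;
        \<And>s. \<tau> \<le> s \<Longrightarrow> supnorm r (lift y s) \<le> b\<rbrakk>
      \<Longrightarrow> supnorm r (lift y t) \<le> \<delta> * supnorm r (lift y \<tau>) + \<kappa> * b + \<rho>"
proof -
  obtain L0 where L0: "\<And>t s. t \<ge> L0 \<Longrightarrow> s \<ge> 0 \<Longrightarrow> \<bar>E (t + s) s\<bar> < \<delta>"
    using uniform_limitD[OF E_lim assms] by (auto simp: eventually_at_top_linorder dist_real_def)
  \<comment> \<open>The maximum with 1 keeps the delay \<open>L + r\<close> positive even for
    \<open>r = 0\<close>.\<close>
  define L where "L = max L0 1"
  show thesis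
  proof (rule that[of "L + r"])
    show "L + r > 0" using r by (simp add: L_def)
    fix y \<tau> t b
    assume y: "y \<in> solution_class r E K \<rho>" and \<tau>: "0 \<le> \<tau>" "\<tau> + (L + r) \<le> t" and "0 \<le> b"
      and b: "\<And>s. \<tau> \<le> s \<Longrightarrow> supnorm r (lift y s) \<le> b"
    show "supnorm r (lift y t) \<le> \<delta> * supnorm r (lift y \<tau>) + \<kappa> * b + \<rho>"
    proof (rule Y_le[OF y])
      show "t \<ge> 0" using \<tau> r by (simp add: L_def)
      fix s assume s: "t - r \<le> s" "s \<le> t"
      have "L0 \<le> s - \<tau>" and s\<tau>: "\<tau> \<le> s" using s \<tau> by (auto simp: L_def)
      then have "E s \<tau> \<le> \<delta>" using L0[of "s - \<tau>" \<tau>] \<tau> by simp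
      then have "E s \<tau> * supnorm r (lift y \<tau>) \<le> \<delta> * supnorm r (lift y \<tau>)"
        using \<tau> by (intro mult_right_mono Y_nonneg[OF y])
      with y_le[OF y \<open>0 \<le> \<tau>\<close> s\<tau> \<open>0 \<le> b\<close> b]
      show "y s \<le> \<delta> * supnorm r (lift y \<tau>) + \<kappa> * b + \<rho>" by linarith
    qed
  qed
qed

section \<open>Part (1): uniform ultimate bound\<close>

lemma eventual_bound:
  assumes "R > 0" "\<epsilon> > 0"
  shows "\<exists>T>0. \<forall>y\<in>solution_class r E K \<rho>. supnorm r (lift y 0) \<le> R \<longrightarrow>
           (\<forall>t>T. supnorm r (lift y t) < 1 / (1 - \<kappa>) * \<rho> + \<epsilon>)"
proof -
  define \<mu> where "\<mu> = 1 / (1 - \<kappa>)"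
  define B where "B = max (\<theta> / (1 - \<kappa>)) 1 * R + \<mu> * \<rho>"
  have \<mu>: "\<mu> > 0" "\<mu> = \<kappa> * \<mu> + 1" using \<kappa> by (auto simp: \<mu>_def field_simps)
  have "B > 0" using \<mu> \<rho> \<open>R > 0\<close> by (auto simp: B_def intro!: add_pos_nonneg mult_pos_pos)
  \<comment> \<open>This choice gives \<open>\<mu> * \<delta> * B = \<epsilon> / 2\<close>, so that
    \<open>l\<close> below is the fixed point of the map sending \<open>b\<close> to
    \<open>\<delta> * B + \<kappa> * b + \<rho>\<close>.\<close>
  define \<delta> where "\<delta> = \<epsilon> / (2 * \<mu> * B)"
  have "\<delta> > 0" using \<open>B > 0\<close> \<mu> assms by (simp add: \<delta>_def)
  define l where "l = \<mu> * \<rho> + \<epsilon> / 2"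
  have l: "\<delta> * B + \<kappa> * l + \<rho> = l"
  proof -
    have "\<epsilon> / 2 = \<mu> * (\<delta> * B)" using \<open>B > 0\<close> \<mu>(1) by (simp add: \<delta>_def)
    then have "l = \<mu> * (\<rho> + \<delta> * B)" by (simp add: l_def algebra_simps)
    also have "\<dots> = \<kappa> * l + (\<rho> + \<delta> * B)"
      unfolding \<open>l = \<mu> * (\<rho> + \<delta> * B)\<close> by (subst \<mu>(2)) (simp add: algebra_simps)
    finally show ?thesis by simp
  qed
  have "l \<ge> 0" using \<mu> \<rho> assms by (simp add: l_def)
  obtain H where "H > 0" and H: "\<And>y \<tau> t b. \<lbrakk>y \<in> solution_class r E K \<rho>; 0 \<le> \<tau>; \<tau> + H \<le> t; 0 \<le> b;
        \<And>s. \<tau> \<le> s \<Longrightarrow> supnorm r (lift y s) \<le> b\<rbrakk>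
      \<Longrightarrow> supnorm r (lift y t) \<le> \<delta> * supnorm r (lift y \<tau>) + \<kappa> * b + \<rho>"
    using delay_estimate[OF \<open>\<delta> > 0\<close>] by metis
  obtain n where n: "\<kappa> ^ n < \<epsilon> / (2 * B)"
    using real_arch_pow_inv[of "\<epsilon> / (2 * B)" \<kappa>] \<kappa> assms \<open>B > 0\<close> by auto
  have "supnorm r (lift y t) < \<mu> * \<rho> + \<epsilon>"
    if y: "y \<in> solution_class r E K \<rho>" and R: "supnorm r (lift y 0) \<le> R" and t: "t > real n * H + 1"
    for y t
  proof -
    have B: "supnorm r (lift y t) \<le> B" if "t \<ge> 0" for t
    proof -
      have "max (\<theta> / (1 - \<kappa>)) 1 * supnorm r (lift y 0) \<le> max (\<theta> / (1 - \<kappa>)) 1 * R"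
        using R by (intro mult_left_mono) auto
      with a_priori_bound[OF y order.refl that] show ?thesis by (simp add: B_def \<mu>_def)
    qed
    \<comment> \<open>Each further delay \<open>H\<close> multiplies the excess over
      \<open>l\<close> by \<open>\<kappa>\<close>. The induction hypothesis holds on the whole
      half-line from \<open>m * H\<close>, as the delay estimate with \<open>\<tau> = m * H\<close>
      requires.\<close>
    have "supnorm r (lift y t) \<le> l + \<kappa> ^ m * B" if "t \<ge> real m * H" for m t
      using that
    proof (induction m arbitrary: t)
      case 0
      then show ?case using B[of t] \<open>l \<ge> 0\<close> by simp
    next
      case (Suc m)
      have m: "real m * H \<ge> 0" using \<open>H > 0\<close> by simp
      have "supnorm r (lift y t)
          \<le> \<delta> * supnorm r (lift y (real m * H)) + \<kappa> * (l + \<kappa> ^ m * B) + \<rho>"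
        using Suc.prems \<open>l \<ge> 0\<close> \<open>B > 0\<close> \<kappa> m
        by (intro H[OF y] Suc.IH) (auto simp: algebra_simps)
      also have "\<dots> \<le> \<delta> * B + \<kappa> * (l + \<kappa> ^ m * B) + \<rho>"
        using B[OF m] \<open>\<delta> > 0\<close> by simp
      also have "\<dots> = l + \<kappa> ^ Suc m * B" by (subst (2) l[symmetric]) (simp add: algebra_simps)
      finally show ?case .
    qed
    from this[of n t] t have "supnorm r (lift y t) \<le> l + \<kappa> ^ n * B" by simp
    also have "\<kappa> ^ n * B < \<epsilon> / 2" using n \<open>B > 0\<close> by (simp add: field_simps)
    finally show ?thesis by (simp add: l_def)
  qed
  then show ?thesis
    using \<open>H > 0\<close> unfolding \<mu>_def[symmetric]
    \<comment> \<open>The added 1 makes \<open>T\<close> positive also when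
      \<open>n = 0\<close>.\<close>
    by (intro exI[of _ "real n * H + 1"]) (auto intro: add_nonneg_pos)
qed

section \<open>Part (2): exponential decay up to \<open>\<gamma> * \<rho>\<close>\<close>

lemma exponential_decay:
  fixes \<mu> c \<gamma> :: real
  assumes small: "\<kappa> < 1 / (1 + \<theta>)"
    and mu: "\<mu> = 1 / (1 - \<kappa>)"
    and c: "c = max (\<theta> / (1 - \<kappa>)) 1"
    and gamma: "\<gamma> = (\<mu> + 1) / (1 - \<kappa> * c)"
  shows "\<exists>M>0. \<exists>l>0. \<forall>y\<in>solution_class r E K \<rho>. \<forall>t\<ge>0.
           supnorm r (lift y t) \<le> M * supnorm r (lift y 0) * exp (- l * t) + \<gamma> * \<rho>"
proof -
  have \<mu>: "\<mu> > 0" "\<kappa> * \<mu> + 1 = \<mu>" using \<kappa> by (auto simp: mu field_simps)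
  have "c \<ge> 1" by (simp add: c)
  \<comment> \<open>This handles the branch \<open>c = \<theta> / (1 - \<kappa>)\<close>; in the
    branch \<open>c = 1\<close> the claim \<open>\<kappa> * c < 1\<close> is just
    \<open>\<kappa> < 1\<close>.\<close>
  have "\<kappa> * \<theta> < 1 - \<kappa>" using small \<theta> by (simp add: field_simps)
  then have \<kappa>c: "\<kappa> * c < 1" using \<kappa> by (auto simp: c max_def field_simps)
  define \<delta> where "\<delta> = (1 - \<kappa> * c) / (\<mu> + 1)"
  define q where "q = \<kappa> * c + \<delta>"
  have "\<delta> > 0" using \<kappa>c \<mu> by (simp add: \<delta>_def)
  have "q > 0" using \<open>\<delta> > 0\<close> \<kappa> \<open>c \<ge> 1\<close> by (simp add: q_def add_pos_pos)
  have q: "1 - q = (1 - \<kappa> * c) * (\<mu> / (\<mu> + 1))"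
    using \<mu>(1) by (simp add: q_def \<delta>_def field_simps)
  moreover have "\<dots> > 0" using \<mu>(1) \<kappa>c by simp
  ultimately have "q < 1" by linarith
  have fixed_point: "q * (\<gamma> * \<rho>) + \<mu> * \<rho> = \<gamma> * \<rho>"
  proof -
    have "(1 - q) * \<gamma> = \<mu>" unfolding q gamma using \<mu>(1) \<kappa>c by simp
    then have "(1 - q) * \<gamma> * \<rho> = \<mu> * \<rho>" by simp
    then show ?thesis by (simp only: left_diff_distrib mult_1_left mult.assoc)
  qed
  \<comment> \<open>With \<open>\<mu> \<le> \<gamma>\<close>, subtracting
    \<open>\<gamma> * \<rho>\<close> from the a priori bound leaves at most
    \<open>c * \<parallel>y_0\<parallel>\<close>, the bound from which the decay starts.\<close>
  have "\<mu> * (1 - \<kappa> * c) \<le> \<mu> * 1" using \<mu>(1) \<kappa> \<open>c \<ge> 1\<close> by (intro mult_left_mono) auto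
  then have "\<mu> \<le> \<gamma>" using \<kappa>c by (simp add: gamma pos_le_divide_eq)
  obtain H where "H > 0" and H: "\<And>y \<tau> t b. \<lbrakk>y \<in> solution_class r E K \<rho>; 0 \<le> \<tau>; \<tau> + H \<le> t; 0 \<le> b;
        \<And>s. \<tau> \<le> s \<Longrightarrow> supnorm r (lift y s) \<le> b\<rbrakk>
      \<Longrightarrow> supnorm r (lift y t) \<le> \<delta> * supnorm r (lift y \<tau>) + \<kappa> * b + \<rho>"
    using delay_estimate[OF \<open>\<delta> > 0\<close>] by metis
  have "supnorm r (lift y t) \<le> c / q * supnorm r (lift y 0) * exp (- (- ln q / H) * t) + \<gamma> * \<rho>"
    if y: "y \<in> solution_class r E K \<rho>" and "t \<ge> 0" for y t
  proof -
    have ap: "supnorm r (lift y t) \<le> c * supnorm r (lift y \<tau>) + \<mu> * \<rho>" if "0 \<le> \<tau>" "\<tau> \<le> t" for \<tau> t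
      using a_priori_bound[OF y that] by (simp add: mu c)
    have "supnorm r (lift y t) - \<gamma> * \<rho>
        \<le> c * supnorm r (lift y 0) / q * exp (- (- ln q / H) * t)"
    proof (rule delayed_contraction_decay[OF \<open>H > 0\<close> \<open>q > 0\<close> \<open>q < 1\<close> _ _ _ \<open>t \<ge> 0\<close>])
      show "supnorm r (lift y t) - \<gamma> * \<rho> \<le> c * supnorm r (lift y 0)" if "t \<ge> 0" for t
        using ap[OF order.refl that] mult_right_mono[OF \<open>\<mu> \<le> \<gamma>\<close> \<rho>] by linarith
      show "0 \<le> c * supnorm r (lift y 0)"
        using \<open>c \<ge> 1\<close> Y_nonneg[OF y, of 0] by simp
      fix t assume "H \<le> t"
      let ?Y = "supnorm r (lift y (t - H))"
      \<comment> \<open>The delay estimate starts at \<open>t - H\<close>, with the a priori bound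
        from that time as \<open>b\<close>.\<close>
      have "supnorm r (lift y t) \<le> \<delta> * ?Y + \<kappa> * (c * ?Y + \<mu> * \<rho>) + \<rho>"
        using \<open>H \<le> t\<close> \<open>c \<ge> 1\<close> \<mu>(1) \<rho> Y_nonneg[OF y, of "t - H"] by (intro H[OF y] ap) auto
      also have "\<dots> = q * ?Y + (\<kappa> * \<mu> + 1) * \<rho>" by (simp add: q_def algebra_simps)
      \<comment> \<open>Subtracting the fixed point \<open>\<gamma> * \<rho>\<close> turns the
        affine recursion into a linear one.\<close>
      finally show "supnorm r (lift y t) - \<gamma> * \<rho> \<le> q * (?Y - \<gamma> * \<rho>)"
        using fixed_point \<mu>(2) by (simp add: right_diff_distrib)
    qed
    then show ?thesis by simp
  qed
  moreover have "c / q > 0" using \<open>c \<ge> 1\<close> \<open>q > 0\<close> by simp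
  moreover have "- ln q / H > 0" using \<open>q < 1\<close> \<open>q > 0\<close> \<open>H > 0\<close> by (simp add: field_simps)
  ultimately show ?thesis by blast
qed

end

theorem theorem1p3:
  fixes r \<rho> \<theta> \<kappa> \<mu> c \<gamma> :: real and E K :: "real \<Rightarrow> real \<Rightarrow> real"
  assumes "r \<ge> 0" and "\<rho> \<ge> 0"
    and E_nonneg: "\<And>t s. t \<ge> 0 \<Longrightarrow> s \<ge> 0 \<Longrightarrow> 0 \<le> E t s"
    and K_nonneg: "\<And>t s. t \<ge> 0 \<Longrightarrow> s \<ge> 0 \<Longrightarrow> 0 \<le> K t s"
    and E_meas: "(\<lambda>(t, s). E t s) \<in> borel_measurable (lebesgue_on ({0..} \<times> {0..}))"
    and K_meas: "(\<lambda>(t, s). K t s) \<in> borel_measurable (lebesgue_on ({0..} \<times> {0..}))"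
    and E_lim: "uniform_limit {0..} (\<lambda>t s. E (t + s) s) (\<lambda>s. 0) at_top"
    and "\<theta> > 0" and "\<kappa> > 0"
    and E_bound: "\<And>t s. 0 \<le> s \<Longrightarrow> s \<le> t \<Longrightarrow> E t s \<le> \<theta>"
    and K_integrable: "\<And>t. t \<ge> 0 \<Longrightarrow> set_integrable lebesgue {0..t} (K t)"
    and K_bound: "\<And>t. t \<ge> 0 \<Longrightarrow> (LINT s:{0..t}|lebesgue. K t s) \<le> \<kappa>"
    and mu: "\<mu> = 1 / (1 - \<kappa>)"
    and c: "c = max (\<theta> / (1 - \<kappa>)) 1"
    and gamma: "\<gamma> = (\<mu> + 1) / (1 - \<kappa> * c)"
  shows "(\<kappa> < 1 \<longrightarrow>
            (\<forall>R>0. \<forall>\<epsilon>>0. \<exists>T>0. \<forall>y\<in>solution_class r E K \<rho>.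
               supnorm r (lift y 0) \<le> R \<longrightarrow>
               (\<forall>t>T. supnorm r (lift y t) < \<mu> * \<rho> + \<epsilon>)))
       \<and> (\<kappa> < 1 / (1 + \<theta>) \<longrightarrow>
            (\<exists>M>0. \<exists>l>0. \<forall>y\<in>solution_class r E K \<rho>. \<forall>t\<ge>0.
               supnorm r (lift y t) \<le> M * supnorm r (lift y 0) * exp (- l * t) + \<gamma> * \<rho>))"
proof (intro conjI impI allI)
  fix R \<epsilon> :: real
  assume "\<kappa> < 1" and "R > 0" "\<epsilon> > 0"
  interpret delay_inequality r \<rho> \<theta> \<kappa> E K
    using assms \<open>\<kappa> < 1\<close> by unfold_locales
  show "\<exists>T>0. \<forall>y\<in>solution_class r E K \<rho>. supnorm r (lift y 0) \<le> R \<longrightarrow>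
          (\<forall>t>T. supnorm r (lift y t) < \<mu> * \<rho> + \<epsilon>)"
    unfolding mu using \<open>R > 0\<close> \<open>\<epsilon> > 0\<close> by (rule eventual_bound)
next
  assume small: "\<kappa> < 1 / (1 + \<theta>)"
  also have "\<dots> < 1" using \<open>\<theta> > 0\<close> by simp
  finally have "\<kappa> < 1" .
  interpret delay_inequality r \<rho> \<theta> \<kappa> E K
    using assms \<open>\<kappa> < 1\<close> by unfold_locales
  show "\<exists>M>0. \<exists>l>0. \<forall>y\<in>solution_class r E K \<rho>. \<forall>t\<ge>0.
          supnorm r (lift y t) \<le> M * supnorm r (lift y 0) * exp (- l * t) + \<gamma> * \<rho>"
    using small mu c gamma by (rule exponential_decay)
qed

end
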